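(* Let $A_1,\dots,A_n,A$ be formulas of $LC2$. Then $A_1,\dots,A_n\vdash_{LC2}A$ if and only if $A_1^C,\dots,A_n^C\vdash_{LM2}A^C$.
   Context: Formulas: second-order predicate logic built from $\perp$ and atomic formulas $R(t_1,\dots,t_k)$ ($R$ a predicate symbol or predicate variable, $t_i$ first-order terms) with $\rightarrow,\forall x,\forall X$; $\neg A=A\rightarrow\perp$; equations $u=v$ abbreviate $\forall Y(Y(u)\rightarrow Y(v))$, a fixed set of equations is given and $a\approx b$ means $a=b$ follows from it. $LAF2$ is second-order intuitionistic natural deduction with rules: hypothesis, $\rightarrow$-intro/elim, $\forall x$-intro (eigenvariable condition)/elim (any term), $\forall X$-intro (eigenvariable)/elim (any formula), and the equational rule (from $A[u/x]$ and $u\approx v$ derive $A[v/x]$). $LC2$ is $LAF2$ plus the axiom $\forall X\{\neg\neg X\rightarrow X\}$ ($X$ of arity $0$). $LM2$: there are in addition, for each arity, classical predicate variables $X_C$; a formula ends with $X$ if it is $X(\vec t)$, or $A\rightarrow B$ with $B$ ending with $X$, or $\forall vA$ with $A$ ending with $X$; a classical type is a formula ending with $\perp$ or a classical variable; $LM2$ = rules of $LAF2$ plus the axiom $\forall X_C\{\neg\neg X_C\rightarrow X_C\}$, $\forall X_C$-introduction (eigenvariable condition) and $\forall X_C$-elimination instantiating $X_C$ only by classical types. Classical translation: to each ordinary predicate variable $X$ associate a classical variable $X_C$ of the same arity; for a formula $A$ of $LC2$, $A^C$ is defined by: $D(\vec t)^C=D(\vec t)$ for $D$ a predicate symbol or $\perp$;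 $X(\vec t)^C=X_C(\vec t)$ for $X$ a predicate variable; $(B\rightarrow D)^C=B^C\rightarrow D^C$; $(\forall xB)^C=\forall xB^C$; $(\forall XB)^C=\forall X_CB^C$.
   Formalization: The direction from LC2 to LM2 is claimed only when A_1,…,A_n,A contain no predicate symbol other than ⊥; it fails for a 0-ary symbol D, as LC2 proves ¬¬D→D and LM2 does not. The direction from LM2 to LC2 is claimed for all formulas. *)

theory Defs
  imports Main
begin

text \<open>
  De Bruijn indices throughout. A symbol or predicate variable is identified by its name or index
  together with the number of arguments it is applied to. First-order variables form one index
  space; predicate variables form a separate index space for every pair of a kind (a value of
  type \<open>'k\<close>) and an arity, and \<open>All2 \<kappa> k\<close> binds index 0 of the space \<open>(\<kappa>, k)\<close> only.
\<close>

datatype 'f tm = Var nat | Fun 'f "'f tm list"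

datatype ('k, 'f, 'p) fm =
    Bot
  | Sym 'p "'f tm list"
  | PVar 'k nat "'f tm list"
  | Imp "('k, 'f, 'p) fm" "('k, 'f, 'p) fm"
  | All1 "('k, 'f, 'p) fm"
  | All2 'k nat "('k, 'f, 'p) fm"

abbreviation Neg :: "('k, 'f, 'p) fm \<Rightarrow> ('k, 'f, 'p) fm" where
  "Neg A \<equiv> Imp A Bot"

record ('f, 'p) language =
  funs :: "('f \<times> nat) set"
  preds :: "('p \<times> nat) set"

fun term_over :: "('f, 'p) language \<Rightarrow> 'f tm \<Rightarrow> bool" where
  "term_over L (Var i) \<longleftrightarrow> True"
| "term_over L (Fun f ts) \<longleftrightarrow> (f, length ts) \<in> funs L \<and> (\<forall>t\<in>set ts. term_over L t)"

primrec fm_over :: "('f, 'p) language \<Rightarrow> ('k, 'f, 'p) fm \<Rightarrow> bool" where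
  "fm_over L Bot \<longleftrightarrow> True"
| "fm_over L (Sym p ts) \<longleftrightarrow> (p, length ts) \<in> preds L \<and> (\<forall>t\<in>set ts. term_over L t)"
| "fm_over L (PVar \<kappa> i ts) \<longleftrightarrow> (\<forall>t\<in>set ts. term_over L t)"
| "fm_over L (Imp A B) \<longleftrightarrow> fm_over L A \<and> fm_over L B"
| "fm_over L (All1 A) \<longleftrightarrow> fm_over L A"
| "fm_over L (All2 \<kappa> k A) \<longleftrightarrow> fm_over L A"

text \<open>
  The predicate symbols occurring in a formula; the constant \<open>Bot\<close> is not one of them. They matter
  because an atom \<open>D(t)\<close> with \<open>D\<close> a predicate symbol is unchanged by the classical translation but
  is not a classical type. For a 0-ary \<open>D\<close>, the formula \<open>\<not>\<not>D \<rightarrow> D\<close> is provable in \<open>LC2\<close>, while its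
  translation is not provable in \<open>LM2\<close>: take truth values \<open>0 < 1 < 2\<close> (a Heyting chain), a
  one-element domain, \<open>\<bottom> = 0\<close> and \<open>D = 1\<close>, let ordinary predicate variables range over all
  values and classical ones over \<open>{0, 2}\<close>; all rules of \<open>LM2\<close> are sound, but \<open>\<not>\<not>D \<rightarrow> D\<close> has value 1.
\<close>

primrec pred_symbols :: "('k, 'f, 'p) fm \<Rightarrow> ('p \<times> nat) set" where
  "pred_symbols Bot = {}"
| "pred_symbols (Sym p ts) = {(p, length ts)}"
| "pred_symbols (PVar \<kappa> i ts) = {}"
| "pred_symbols (Imp A B) = pred_symbols A \<union> pred_symbols B"
| "pred_symbols (All1 A) = pred_symbols A"
| "pred_symbols (All2 \<kappa> k A) = pred_symbols A"


subsection \<open>First-order substitution\<close>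

primrec tsubst :: "(nat \<Rightarrow> 'f tm) \<Rightarrow> 'f tm \<Rightarrow> 'f tm" where
  "tsubst \<sigma> (Var i) = \<sigma> i"
| "tsubst \<sigma> (Fun f ts) = Fun f (map (tsubst \<sigma>) ts)"

definition up1 :: "(nat \<Rightarrow> 'f tm) \<Rightarrow> nat \<Rightarrow> 'f tm" where
  "up1 \<sigma> = case_nat (Var 0) (\<lambda>i. tsubst (\<lambda>j. Var (Suc j)) (\<sigma> i))"

primrec subst1 :: "(nat \<Rightarrow> 'f tm) \<Rightarrow> ('k, 'f, 'p) fm \<Rightarrow> ('k, 'f, 'p) fm" where
  "subst1 \<sigma> Bot = Bot"
| "subst1 \<sigma> (Sym p ts) = Sym p (map (tsubst \<sigma>) ts)"
| "subst1 \<sigma> (PVar \<kappa> i ts) = PVar \<kappa> i (map (tsubst \<sigma>) ts)"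
| "subst1 \<sigma> (Imp A B) = Imp (subst1 \<sigma> A) (subst1 \<sigma> B)"
| "subst1 \<sigma> (All1 A) = All1 (subst1 (up1 \<sigma>) A)"
| "subst1 \<sigma> (All2 \<kappa> k A) = All2 \<kappa> k (subst1 \<sigma> A)"

definition shift1 :: "('k, 'f, 'p) fm \<Rightarrow> ('k, 'f, 'p) fm" where
  "shift1 = subst1 (\<lambda>j. Var (Suc j))"

definition inst1 :: "'f tm \<Rightarrow> ('k, 'f, 'p) fm \<Rightarrow> ('k, 'f, 'p) fm" where
  "inst1 t = subst1 (case_nat t Var)"


subsection \<open>Second-order substitution\<close>

definition up_ren :: "'k \<Rightarrow> nat \<Rightarrow> ('k \<Rightarrow> nat \<Rightarrow> nat \<Rightarrow> nat) \<Rightarrow> 'k \<Rightarrow> nat \<Rightarrow> nat \<Rightarrow> nat" where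
  "up_ren \<kappa> k \<rho> \<kappa>' k' =
    (if \<kappa>' = \<kappa> \<and> k' = k then case_nat 0 (\<lambda>i. Suc (\<rho> \<kappa> k i)) else \<rho> \<kappa>' k')"

primrec rename2 :: "('k \<Rightarrow> nat \<Rightarrow> nat \<Rightarrow> nat) \<Rightarrow> ('k, 'f, 'p) fm \<Rightarrow> ('k, 'f, 'p) fm" where
  "rename2 \<rho> Bot = Bot"
| "rename2 \<rho> (Sym p ts) = Sym p ts"
| "rename2 \<rho> (PVar \<kappa> i ts) = PVar \<kappa> (\<rho> \<kappa> (length ts) i) ts"
| "rename2 \<rho> (Imp A B) = Imp (rename2 \<rho> A) (rename2 \<rho> B)"
| "rename2 \<rho> (All1 A) = All1 (rename2 \<rho> A)"
| "rename2 \<rho> (All2 \<kappa> k A) = All2 \<kappa> k (rename2 (up_ren \<kappa> k \<rho>) A)"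

definition shift2 :: "'k \<Rightarrow> nat \<Rightarrow> ('k, 'f, 'p) fm \<Rightarrow> ('k, 'f, 'p) fm" where
  "shift2 \<kappa> k = rename2 (\<lambda>\<kappa>' k' i. if \<kappa>' = \<kappa> \<and> k' = k then Suc i else i)"

text \<open>
  A \<open>k\<close>-ary predicate \<open>\<lambda>x\<^sub>1 \<dots> x\<^sub>k. G\<close> is represented by the formula \<open>G\<close> in which the first-order
  indices \<open>0, \<dots>, k - 1\<close> are the arguments and index \<open>k + j\<close> is the ambient variable \<open>j\<close>.
\<close>

definition apply_pred :: "('k, 'f, 'p) fm \<Rightarrow> 'f tm list \<Rightarrow> ('k, 'f, 'p) fm" where
  "apply_pred G ts = subst1 (\<lambda>j. if j < length ts then ts ! j else Var (j - length ts)) G"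

definition pred_var :: "'k \<Rightarrow> nat \<Rightarrow> nat \<Rightarrow> ('k, 'f, 'p) fm" where
  "pred_var \<kappa> k i = PVar \<kappa> i (map Var [0..<k])"

definition under_All1 ::
  "('k \<Rightarrow> nat \<Rightarrow> nat \<Rightarrow> ('k, 'f, 'p) fm) \<Rightarrow> 'k \<Rightarrow> nat \<Rightarrow> nat \<Rightarrow> ('k, 'f, 'p) fm" where
  "under_All1 \<theta> \<kappa> k i = subst1 (\<lambda>j. if j < k then Var j else Var (Suc j)) (\<theta> \<kappa> k i)"

definition under_All2 ::
  "'k \<Rightarrow> nat \<Rightarrow> ('k \<Rightarrow> nat \<Rightarrow> nat \<Rightarrow> ('k, 'f, 'p) fm) \<Rightarrow> 'k \<Rightarrow> nat \<Rightarrow> nat \<Rightarrow> ('k, 'f, 'p) fm" where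
  "under_All2 \<kappa> k \<theta> \<kappa>' k' =
    (if \<kappa>' = \<kappa> \<and> k' = k then case_nat (pred_var \<kappa> k 0) (\<lambda>i. shift2 \<kappa> k (\<theta> \<kappa> k i))
     else (\<lambda>i. shift2 \<kappa> k (\<theta> \<kappa>' k' i)))"

primrec subst2 ::
  "('k \<Rightarrow> nat \<Rightarrow> nat \<Rightarrow> ('k, 'f, 'p) fm) \<Rightarrow> ('k, 'f, 'p) fm \<Rightarrow> ('k, 'f, 'p) fm" where
  "subst2 \<theta> Bot = Bot"
| "subst2 \<theta> (Sym p ts) = Sym p ts"
| "subst2 \<theta> (PVar \<kappa> i ts) = apply_pred (\<theta> \<kappa> (length ts) i) ts"
| "subst2 \<theta> (Imp A B) = Imp (subst2 \<theta> A) (subst2 \<theta> B)"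
| "subst2 \<theta> (All1 A) = All1 (subst2 (under_All1 \<theta>) A)"
| "subst2 \<theta> (All2 \<kappa> k A) = All2 \<kappa> k (subst2 (under_All2 \<kappa> k \<theta>) A)"

definition inst2 :: "'k \<Rightarrow> nat \<Rightarrow> ('k, 'f, 'p) fm \<Rightarrow> ('k, 'f, 'p) fm \<Rightarrow> ('k, 'f, 'p) fm" where
  "inst2 \<kappa> k G = subst2 (\<lambda>\<kappa>' k'.
     if \<kappa>' = \<kappa> \<and> k' = k then case_nat G (pred_var \<kappa> k) else pred_var \<kappa>' k')"


subsection \<open>Natural deduction\<close>

text \<open>
  The rules of \<open>LAF2\<close>, over the language \<open>L\<close> and with the relation \<open>eqv\<close> as side condition of the
  equational rule, extended by a set \<open>Ax\<close> of axioms; \<open>adm \<kappa> G\<close> says that \<open>G\<close> may be substituted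
  for predicate variables of kind \<open>\<kappa>\<close>. Shifting the hypotheses in \<open>All1I\<close> and \<open>All2I\<close> makes the
  variable with index 0 fresh for them: this is the eigenvariable condition.
\<close>

inductive natded ::
  "('f, 'p) language \<Rightarrow> ('f tm \<Rightarrow> 'f tm \<Rightarrow> bool) \<Rightarrow> ('k \<Rightarrow> ('k, 'f, 'p) fm \<Rightarrow> bool) \<Rightarrow>
   ('k, 'f, 'p) fm set \<Rightarrow> ('k, 'f, 'p) fm list \<Rightarrow> ('k, 'f, 'p) fm \<Rightarrow> bool"
  for L eqv adm Ax where
  Hyp: "\<forall>B\<in>set \<Gamma>. fm_over L B \<Longrightarrow> A \<in> set \<Gamma> \<Longrightarrow> natded L eqv adm Ax \<Gamma> A"
| Axiom: "\<forall>B\<in>set \<Gamma>. fm_over L B \<Longrightarrow> A \<in> Ax \<Longrightarrow> natded L eqv adm Ax \<Gamma> A"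
| ImpI: "natded L eqv adm Ax (A # \<Gamma>) B \<Longrightarrow> natded L eqv adm Ax \<Gamma> (Imp A B)"
| ImpE: "natded L eqv adm Ax \<Gamma> (Imp A B) \<Longrightarrow> natded L eqv adm Ax \<Gamma> A \<Longrightarrow> natded L eqv adm Ax \<Gamma> B"
| All1I: "natded L eqv adm Ax (map shift1 \<Gamma>) A \<Longrightarrow> natded L eqv adm Ax \<Gamma> (All1 A)"
| All1E: "natded L eqv adm Ax \<Gamma> (All1 A) \<Longrightarrow> term_over L t \<Longrightarrow> natded L eqv adm Ax \<Gamma> (inst1 t A)"
| All2I: "natded L eqv adm Ax (map (shift2 \<kappa> k) \<Gamma>) A \<Longrightarrow> natded L eqv adm Ax \<Gamma> (All2 \<kappa> k A)"
| All2E: "natded L eqv adm Ax \<Gamma> (All2 \<kappa> k A) \<Longrightarrow> fm_over L G \<Longrightarrow> adm \<kappa> G \<Longrightarrow>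
    natded L eqv adm Ax \<Gamma> (inst2 \<kappa> k G A)"
| Equ: "natded L eqv adm Ax \<Gamma> (inst1 u A) \<Longrightarrow> eqv u v \<Longrightarrow> natded L eqv adm Ax \<Gamma> (inst1 v A)"

text \<open>Formulas of \<open>LAF2\<close> and \<open>LC2\<close> have a single kind of predicate variables.\<close>

type_synonym ('f, 'p) lc_fm = "(unit, 'f, 'p) fm"

definition Eq :: "'f tm \<Rightarrow> 'f tm \<Rightarrow> ('f, 'p) lc_fm" where
  "Eq u v = All2 () 1 (Imp (PVar () 0 [u]) (PVar () 0 [v]))"

fun tvars :: "'f tm \<Rightarrow> nat set" where
  "tvars (Var i) = {i}"
| "tvars (Fun f ts) = (\<Union>t\<in>set ts. tvars t)"

text \<open>
  The given equations are understood as universally closed. Consequence is provability of the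
  formula \<open>Eq a b\<close> in second-order intuitionistic logic; taking \<open>(=)\<close> for \<open>eqv\<close> makes the equational
  rule trivial there.
\<close>

definition equation_closures :: "('f tm \<times> 'f tm) set \<Rightarrow> ('f, 'p) lc_fm set" where
  "equation_closures E =
    {(All1 ^^ n) (Eq u v) | n u v. (u, v) \<in> E \<and> tvars u \<union> tvars v \<subseteq> {..<n}}"

definition eq_consequence ::
  "('f, 'p) language \<Rightarrow> ('f tm \<times> 'f tm) set \<Rightarrow> 'f tm \<Rightarrow> 'f tm \<Rightarrow> bool" where
  "eq_consequence L E a b \<longleftrightarrow>
    (\<exists>\<Gamma>. set \<Gamma> \<subseteq> equation_closures E \<and> natded L (=) (\<lambda>_ _. True) {} \<Gamma> (Eq a b))"

definition stability :: "'k \<Rightarrow> ('k, 'f, 'p) fm" where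
  "stability \<kappa> = All2 \<kappa> 0 (Imp (Neg (Neg (PVar \<kappa> 0 []))) (PVar \<kappa> 0 []))"

definition LC2 ::
  "('f, 'p) language \<Rightarrow> ('f tm \<times> 'f tm) set \<Rightarrow> ('f, 'p) lc_fm list \<Rightarrow> ('f, 'p) lc_fm \<Rightarrow> bool" where
  "LC2 L E = natded L (eq_consequence L E) (\<lambda>_ _. True) {stability ()}"


subsection \<open>Mixed logic\<close>

datatype kind = Ordinary | Classical

type_synonym ('f, 'p) lm_fm = "(kind, 'f, 'p) fm"

text \<open>
  The atom a formula ends with. Quantifiers of all sorts are skipped, including one that binds the
  final predicate variable, so the index in a resulting \<open>PVar\<close> has no meaning outside its scope;
  only its kind is used.
\<close>

primrec ending :: "('k, 'f, 'p) fm \<Rightarrow> ('k, 'f, 'p) fm" where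
  "ending Bot = Bot"
| "ending (Sym p ts) = Sym p ts"
| "ending (PVar \<kappa> i ts) = PVar \<kappa> i ts"
| "ending (Imp A B) = ending B"
| "ending (All1 A) = ending A"
| "ending (All2 \<kappa> k A) = ending A"

definition classical_type :: "('f, 'p) lm_fm \<Rightarrow> bool" where
  "classical_type A \<longleftrightarrow> ending A = Bot \<or> (\<exists>i ts. ending A = PVar Classical i ts)"

definition LM2 ::
  "('f, 'p) language \<Rightarrow> ('f tm \<times> 'f tm) set \<Rightarrow> ('f, 'p) lm_fm list \<Rightarrow> ('f, 'p) lm_fm \<Rightarrow> bool" where
  "LM2 L E = natded L (eq_consequence L E) (\<lambda>\<kappa> G. \<kappa> = Classical \<longrightarrow> classical_type G)
     {stability Classical}"

primrec classical_translation :: "('f, 'p) lc_fm \<Rightarrow> ('f, 'p) lm_fm" where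
  "classical_translation Bot = Bot"
| "classical_translation (Sym p ts) = Sym p ts"
| "classical_translation (PVar \<kappa> i ts) = PVar Classical i ts"
| "classical_translation (Imp A B) = Imp (classical_translation A) (classical_translation B)"
| "classical_translation (All1 A) = All1 (classical_translation A)"
| "classical_translation (All2 \<kappa> k A) = All2 Classical k (classical_translation A)"

end

theory Submission
  imports Defs
begin

text \<open>
  Both implications are instances of one fact: a map that merges kinds of predicate variables and
  replaces some atoms by \<open>\<bottom>\<close> commutes with all substitutions, hence sends derivations to
  derivations. From \<open>LC2\<close> to \<open>LM2\<close>, every predicate symbol is replaced by \<open>\<bottom>\<close>; this is harmless
  for hypotheses and conclusion, and makes each formula instantiated along the derivation a
  classical type. From \<open>LM2\<close> to \<open>LC2\<close>, ordinary and classical variables are merged.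
\<close>

text \<open>
  Under a binder of kind \<open>\<kappa>\<close>, the variables of the other kinds with the same image are shifted too.
\<close>

definition up_merge ::
  "('k \<Rightarrow> 'l) \<Rightarrow> 'k \<Rightarrow> nat \<Rightarrow> ('k \<Rightarrow> nat \<Rightarrow> nat \<Rightarrow> nat) \<Rightarrow> 'k \<Rightarrow> nat \<Rightarrow> nat \<Rightarrow> nat" where
  "up_merge g \<kappa> k \<rho> \<kappa>' k' =
    (if g \<kappa>' = g \<kappa> \<and> k' = k
     then (if \<kappa>' = \<kappa> then case_nat 0 (\<lambda>i. Suc (\<rho> \<kappa> k i)) else (\<lambda>i. Suc (\<rho> \<kappa>' k i)))
     else \<rho> \<kappa>' k')"

text \<open>\<open>P\<close> is the set of predicate symbols that survive. The index map
  \<open>\<rho>\<close> is carried along because index spaces get merged: a bound variable takes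
  index 0 of the common space, so variables of other kinds with the same image must make
  room.\<close>

primrec merge_kinds ::
  "('k \<Rightarrow> 'l) \<Rightarrow> ('p \<times> nat) set \<Rightarrow> ('k \<Rightarrow> nat \<Rightarrow> nat \<Rightarrow> nat) \<Rightarrow> ('k, 'f, 'p) fm \<Rightarrow> ('l, 'f, 'p) fm" where
  "merge_kinds g P \<rho> Bot = Bot"
| "merge_kinds g P \<rho> (Sym p ts) = (if (p, length ts) \<in> P then Sym p ts else Bot)"
| "merge_kinds g P \<rho> (PVar \<kappa> i ts) = PVar (g \<kappa>) (\<rho> \<kappa> (length ts) i) ts"
| "merge_kinds g P \<rho> (Imp A B) = Imp (merge_kinds g P \<rho> A) (merge_kinds g P \<rho> B)"
| "merge_kinds g P \<rho> (All1 A) = All1 (merge_kinds g P \<rho> A)"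
| "merge_kinds g P \<rho> (All2 \<kappa> k A) = All2 (g \<kappa>) k (merge_kinds g P (up_merge g \<kappa> k \<rho>) A)"

lemma fm_over_merge_kinds: "fm_over L A \<Longrightarrow> fm_over L (merge_kinds g P \<rho> A)"
  by (induction A arbitrary: \<rho>) auto

lemma merge_kinds_subst1: "merge_kinds g P \<rho> (subst1 \<sigma> A) = subst1 \<sigma> (merge_kinds g P \<rho> A)"
  by (induction A arbitrary: \<rho> \<sigma>) auto

text \<open>Two index maps occur because \<open>r\<close> may change the free variables:
  \<open>\<rho>\<close> reads indices before renaming, \<open>\<rho>'\<close> after it.\<close>

lemma merge_kinds_rename2:
  assumes "\<And>\<kappa> k i. \<rho>' \<kappa> k (r \<kappa> k i) = r' (g \<kappa>) k (\<rho> \<kappa> k i)"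
  shows "merge_kinds g P \<rho>' (rename2 r A) = rename2 r' (merge_kinds g P \<rho> A)"
  using assms
proof (induction A arbitrary: \<rho> \<rho>' r r')
  case (All2 \<kappa>\<^sub>0 k\<^sub>0 A)
  \<comment> \<open>For a kind other than \<open>\<kappa>\<^sub>0\<close> with the same image,
    \<open>up_ren\<close> on the left does nothing, but \<open>up_merge\<close> adds a
    \<open>Suc\<close> on both sides, which the \<open>up_ren\<close> on the right passes
    through.\<close>
  have "up_merge g \<kappa>\<^sub>0 k\<^sub>0 \<rho>' \<kappa> k (up_ren \<kappa>\<^sub>0 k\<^sub>0 r \<kappa> k i)
      = up_ren (g \<kappa>\<^sub>0) k\<^sub>0 r' (g \<kappa>) k (up_merge g \<kappa>\<^sub>0 k\<^sub>0 \<rho> \<kappa> k i)" for \<kappa> k i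
    using All2.prems[of \<kappa>] by (auto simp: up_merge_def up_ren_def split: nat.split)
  then show ?case
    by (auto intro!: All2.IH)
next
  case (Imp A B)
  show ?case
    by (auto intro!: Imp.IH Imp.prems)
next
  case (All1 A)
  show ?case
    by (auto intro!: All1.IH All1.prems)
qed auto

lemma merge_kinds_shift2:
  "merge_kinds g P (up_merge g \<kappa> k \<rho>) (shift2 \<kappa> k A) = shift2 (g \<kappa>) k (merge_kinds g P \<rho> A)"
  unfolding shift2_def by (rule merge_kinds_rename2) (auto simp: up_merge_def)

text \<open>Here \<open>\<rho>'\<close> acts on the variables being replaced and
  \<open>\<rho>\<close> on those of the substituted formulas. The substitution
  \<open>\<theta>'\<close> is constrained only at the images of variables under
  \<open>\<rho>'\<close>.\<close>

lemma merge_kinds_subst2: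
  assumes "\<And>\<kappa> k i. merge_kinds g P \<rho> (\<theta> \<kappa> k i) = \<theta>' (g \<kappa>) k (\<rho>' \<kappa> k i)"
  shows "merge_kinds g P \<rho> (subst2 \<theta> A) = subst2 \<theta>' (merge_kinds g P \<rho>' A)"
  using assms
proof (induction A arbitrary: \<rho> \<rho>' \<theta> \<theta>')
  case (PVar \<kappa> i ts)
  then show ?case
    by (simp add: apply_pred_def merge_kinds_subst1)
next
  case (All1 A)
  have "merge_kinds g P \<rho> (under_All1 \<theta> \<kappa> k i) = under_All1 \<theta>' (g \<kappa>) k (\<rho>' \<kappa> k i)" for \<kappa> k i
    using All1.prems by (simp add: under_All1_def merge_kinds_subst1)
  then show ?case
    by (auto intro!: All1.IH)
next
  case (All2 \<kappa>\<^sub>0 k\<^sub>0 A)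
  have "merge_kinds g P (up_merge g \<kappa>\<^sub>0 k\<^sub>0 \<rho>) (under_All2 \<kappa>\<^sub>0 k\<^sub>0 \<theta> \<kappa> k i)
      = under_All2 (g \<kappa>\<^sub>0) k\<^sub>0 \<theta>' (g \<kappa>) k (up_merge g \<kappa>\<^sub>0 k\<^sub>0 \<rho>' \<kappa> k i)" for \<kappa> k i
    using All2.prems[of \<kappa>]
    by (auto simp: under_All2_def merge_kinds_shift2 up_merge_def pred_var_def split: nat.split)
  then show ?case
    by (auto intro!: All2.IH)
qed auto

text \<open>Under \<open>up_merge\<close> only the bound variable is sent to index 0, where
  \<open>G\<close> is put; all others of the same arity and image become successors, which
  \<open>inst2\<close> lowers again.\<close>

lemma merge_kinds_inst2:
  "merge_kinds g P \<rho> (inst2 \<kappa> k G A)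
    = inst2 (g \<kappa>) k (merge_kinds g P \<rho> G) (merge_kinds g P (up_merge g \<kappa> k \<rho>) A)"
  unfolding inst2_def
  by (rule merge_kinds_subst2) (auto simp: up_merge_def pred_var_def split: nat.split)

lemma merge_kinds_stability: "merge_kinds g P \<rho> (stability \<kappa>) = stability (g \<kappa>)"
  by (simp add: stability_def up_merge_def)

text \<open>Each rule is mapped to an instance of itself by the commutation lemmas; terms are
  untouched, so \<open>eqv\<close> stays the same. All \<open>\<rho>\<close> are treated at once
  since \<open>All2I\<close> passes to \<open>up_merge g \<kappa> k \<rho>\<close>.\<close>

lemma natded_merge_kinds:
  assumes "natded L eqv adm Ax \<Gamma> A"
    and adm: "\<And>\<kappa> G \<rho>. adm \<kappa> G \<Longrightarrow> adm' (g \<kappa>) (merge_kinds g P \<rho> G)"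
    and Ax: "\<And>A \<rho>. A \<in> Ax \<Longrightarrow> merge_kinds g P \<rho> A \<in> Ax'"
  shows "natded L eqv adm' Ax' (map (merge_kinds g P \<rho>) \<Gamma>) (merge_kinds g P \<rho> A)"
  using assms(1)
proof (induction arbitrary: \<rho>)
  case (Hyp \<Gamma> A)
  then show ?case
    by (intro natded.Hyp) (auto simp: fm_over_merge_kinds)
next
  case (Axiom \<Gamma> A)
  then show ?case
    by (intro natded.Axiom) (auto simp: fm_over_merge_kinds Ax)
next
  case (ImpI A \<Gamma> B)
  then show ?case
    by (auto intro: natded.ImpI)
next
  case (ImpE \<Gamma> A B)
  then show ?case
    by (auto intro: natded.ImpE)
next
  case (All1I \<Gamma> A)
  have "map (merge_kinds g P \<rho>) (map shift1 \<Gamma>) = map shift1 (map (merge_kinds g P \<rho>) \<Gamma>)"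
    by (simp add: shift1_def merge_kinds_subst1)
  then show ?case
    using All1I.IH[of \<rho>] by (simp only: merge_kinds.simps natded.All1I)
next
  case (All1E \<Gamma> A t)
  then show ?case
    using natded.All1E by (fastforce simp: inst1_def merge_kinds_subst1)
next
  case (All2I \<kappa> k \<Gamma> A)
  have "map (merge_kinds g P (up_merge g \<kappa> k \<rho>)) (map (shift2 \<kappa> k) \<Gamma>)
      = map (shift2 (g \<kappa>) k) (map (merge_kinds g P \<rho>) \<Gamma>)"
    by (simp add: merge_kinds_shift2)
  then show ?case
    using All2I.IH[of "up_merge g \<kappa> k \<rho>"] by (simp only: merge_kinds.simps natded.All2I)
next
  case (All2E \<Gamma> \<kappa> k A G)
  then show ?case
    by (auto simp: merge_kinds_inst2 fm_over_merge_kinds adm intro!: natded.All2E)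
next
  case (Equ \<Gamma> u A v)
  then show ?case
    using natded.Equ by (fastforce simp: inst1_def merge_kinds_subst1)
qed

text \<open>With \<open>P\<close> empty and all kinds sent to \<open>Classical\<close>, the only
  atoms left are \<open>Bot\<close> and classical variables.\<close>

lemma classical_type_merge_kinds: "classical_type (merge_kinds (\<lambda>_. Classical) {} \<rho> A)"
  by (induction A arbitrary: \<rho>) (auto simp: classical_type_def)

lemma merge_kinds_eq_classical_translation:
  assumes "pred_symbols A = {}" and "\<rho> = (\<lambda>_ _ i. i)"
  shows "merge_kinds (\<lambda>_. Classical) {} \<rho> A = classical_translation A"
  using assms
proof (induction A arbitrary: \<rho>)
  case (All2 \<kappa> k A)
  have "up_merge (\<lambda>_. Classical) \<kappa> k \<rho> = (\<lambda>_ _ i. i)"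
    using All2.prems(2) by (auto simp: up_merge_def fun_eq_iff split: nat.split)
  then show ?case
    using All2 by simp
qed auto

text \<open>A translated formula has only classical variables. Asking for the identity at
  \<open>Classical\<close> alone survives binders, whereas \<open>up_merge\<close> shifts the
  ordinary variables.\<close>

lemma merge_kinds_classical_translation:
  assumes "\<rho> Classical = (\<lambda>_ i. i)"
  shows "merge_kinds (\<lambda>_. ()) UNIV \<rho> (classical_translation A) = A"
  using assms
proof (induction A arbitrary: \<rho>)
  case (All2 \<kappa> k A)
  have "up_merge (\<lambda>_. ()) Classical k \<rho> Classical = (\<lambda>_ i. i)"
    using All2.prems by (auto simp: up_merge_def fun_eq_iff split: nat.split)
  then show ?case
    using All2 by simp
qed auto

lemma LC2_imp_LM2:
  assumes "LC2 L E As A" and "\<forall>B\<in>set (A # As). pred_symbols B = {}"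
  shows "LM2 L E (map classical_translation As) (classical_translation A)"
proof -
  let ?T = "merge_kinds (\<lambda>_. Classical) {} (\<lambda>_ _ i. i)"
  have "LM2 L E (map ?T As) (?T A)"
    unfolding LM2_def
    by (rule natded_merge_kinds[OF assms(1)[unfolded LC2_def]])
      (auto simp: classical_type_merge_kinds merge_kinds_stability)
  moreover have "map ?T As = map classical_translation As" "?T A = classical_translation A"
    using assms(2) by (auto simp: merge_kinds_eq_classical_translation)
  ultimately show ?thesis
    by simp
qed

text \<open>\<open>LC2\<close> admits every formula for instantiation, and both kinds of variables
  merge into its single kind; \<open>UNIV\<close> keeps all predicate symbols.\<close>

lemma LM2_imp_LC2:
  assumes "LM2 L E (map classical_translation As) (classical_translation A)"
  shows "LC2 L E As A"
proof -
  let ?T = "merge_kinds (\<lambda>_. ()) UNIV (\<lambda>_ _ i. i)"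
  have "LC2 L E (map ?T (map classical_translation As)) (?T (classical_translation A))"
    unfolding LC2_def
    by (rule natded_merge_kinds[OF assms[unfolded LM2_def]]) (auto simp: merge_kinds_stability)
  then show ?thesis
    by (simp add: merge_kinds_classical_translation comp_def)
qed

theorem theorem3p3:
  fixes L :: "('f, 'p) language"
    and E :: "('f tm \<times> 'f tm) set"
    and As :: "('f, 'p) lc_fm list"
    and A :: "('f, 'p) lc_fm"
  assumes "\<forall>B\<in>set (A # As). fm_over L B"
  shows "((\<forall>B\<in>set (A # As). pred_symbols B = {}) \<longrightarrow>
      (LC2 L E As A \<longleftrightarrow> LM2 L E (map classical_translation As) (classical_translation A)))
    \<and> (LM2 L E (map classical_translation As) (classical_translation A) \<longrightarrow> LC2 L E As A)"
  using LC2_imp_LM2 LM2_imp_LC2 by blast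

end
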